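(* Let $p_n$ be a random monic polynomial of degree $n$ whose roots $x_1, \dots, x_n$ are i.i.d. real random variables, with a common distribution (that of a random variable $X$) satisfying $\mathbb{E}X = 0$, $\mathbb{E}X^2 = 1$ and $\mathbb{E}|X|^k < \infty$ for all $k \in \mathbb{N}$. Fix $\ell \in \mathbb{N}$ and a compact interval $I \subset \mathbb{R}$. The $(n-\ell)$-th derivative of $p_n$ satisfies, for all $x \in I$, as $n \to \infty$, $$ n^{\ell/2}\, \frac{\ell!}{n!} \cdot p_n^{(n-\ell)}\left(\frac{x}{\sqrt{n}}\right) = (1 + o(1)) \cdot He_\ell(x + \gamma_n),$$ where $He_\ell$ is the $\ell$-th probabilists' Hermite polynomial and $\gamma_n$ is a random variable converging to the standard $\mathcal{N}(0,1)$ Gaussian as $n \to \infty$.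
   Context: $p_n(x) = \prod_{i=1}^{n}(x - x_i)$, and $p_n^{(n-\ell)}$ denotes its $(n-\ell)$-th derivative. The probabilists' Hermite polynomials are defined by $He_\ell(x) = (-1)^\ell e^{x^2/2} \frac{d^\ell}{dx^\ell} e^{-x^2/2}$, so that $He_0(x)=1$, $He_1(x) = x$, $He_2(x) = x^2-1$, $He_3(x) = x^3-3x$. *)

theory Defs
  imports "HOL-Probability.Probability" "HOL-Computational_Algebra.Polynomial"
begin

definition root_poly :: "(nat \<Rightarrow> real) \<Rightarrow> nat \<Rightarrow> real poly" where
  "root_poly r n = (\<Prod>i=1..n. [:- r i, 1:])"

definition hermite_He :: "nat \<Rightarrow> real \<Rightarrow> real" where
  "hermite_He l x =
     (-1) ^ l * exp (x\<^sup>2 / 2) * (deriv ^^ l) (\<lambda>t. exp (- (t\<^sup>2 / 2))) x"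

text \<open>
  \<open>F\<^sub>n(x) = (1 + o(1)) G\<^sub>n(x)\<close> for random functions of \<open>x \<in> I\<close>: the term \<open>o(1)\<close> tends to \<open>0\<close> in
  probability, at a rate uniform in \<open>x \<in> I\<close>. As in the usual definition of \<open>F - G \<in> o(G)\<close>, the
  bound on the relative error is written without division, so that it also makes sense
  (and requires \<open>F = 0\<close>) where \<open>G\<close> vanishes. The supremum over \<open>x\<close> is outside the probability:
  for two random polynomials with distinct roots in \<open>I\<close>, the relative error cannot be small
  for all \<open>x \<in> I\<close> at the same sample point.
\<close>

definition eq_one_plus_o_prob ::
  "'a measure \<Rightarrow> real set \<Rightarrow> (nat \<Rightarrow> real \<Rightarrow> 'a \<Rightarrow> real) \<Rightarrow> (nat \<Rightarrow> real \<Rightarrow> 'a \<Rightarrow> real) \<Rightarrow> bool" where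
  "eq_one_plus_o_prob M I F G \<longleftrightarrow>
     (\<forall>\<epsilon>>0. uniform_limit I
        (\<lambda>n x. measure M {\<omega> \<in> space M. \<bar>F n x \<omega> - G n x \<omega>\<bar> > \<epsilon> * \<bar>G n x \<omega>\<bar>})
        (\<lambda>x. 0) sequentially)"

end

theory Submission
  imports Defs
    "HOL-Computational_Algebra.Polynomial_FPS"
    "HOL-Computational_Algebra.Fundamental_Theorem_Algebra"
    "HOL-Real_Asymp.Real_Asymp"
begin

text \<open>
  Put \<open>z = x / sqrt n\<close>. By Taylor's formula at \<open>z\<close>, the derivative \<open>p\<^sub>n\<^bsup>(n - l)\<^esup>(z)\<close> is \<open>(n - l)!\<close> times the
  elementary symmetric polynomial \<open>e\<^sub>l\<close> of the shifted numbers \<open>z - r\<^sub>i\<close>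
  (lemma \<open>root_poly_higher_pderiv\<close>). So the left-hand side is, up to a deterministic factor tending
  to \<open>1\<close>, the normalised quantity \<open>A\<^sub>l = l! e\<^sub>l / n\<^bsup>l/2\<^esup>\<close>.

  Newton's identities express \<open>A\<^sub>0, A\<^sub>1, ...\<close> recursively through the normalised power sums
  \<open>q\<^sub>j = n\<^bsup>-j/2\<^esup> \<Sum>\<^sub>i (z - r\<^sub>i)\<^sup>j\<close>. If one substitutes \<open>q\<^sub>2 = 1\<close> and \<open>q\<^sub>j = 0\<close> for \<open>j \<ge> 3\<close>, the recursion
  becomes the three-term recursion of the Hermite polynomials at the point \<open>q\<^sub>1\<close>
  (lemma \<open>hermite_poly_newton\<close>). In the random setting \<open>q\<^sub>1 = x + \<gamma>\<^sub>n\<close> exactly, with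
  \<open>\<gamma>\<^sub>n = - (r\<^sub>1 + ... + r\<^sub>n) / sqrt n\<close>, which is asymptotically normal by the central limit theorem;
  \<open>q\<^sub>2\<close> tends to \<open>1\<close> by the law of large numbers; and \<open>q\<^sub>j\<close> tends to \<open>0\<close> for \<open>j \<ge> 3\<close> since the
  \<open>j\<close>-th absolute moment is finite. Hence \<open>A\<^sub>l - He\<^sub>l(x + \<gamma>\<^sub>n)\<close> tends to \<open>0\<close> in probability, uniformly in \<open>x\<close>.

  To pass from this additive error to the relative one, it remains to see that \<open>He\<^sub>l(x + \<gamma>\<^sub>n)\<close> is
  rarely small, uniformly in \<open>x\<close>. The set where a nonzero polynomial is small lies in a small
  neighbourhood of a fixed finite set (lemma \<open>poly_small_near_finite_set\<close>), and \<open>\<gamma>\<^sub>n\<close> rarely enters a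
  short interval because its limit law has no atoms (lemma \<open>weak_conv_small_ball\<close>).
\<close>

section \<open>Newton's identities and the derivative of a product of linear factors\<close>

text \<open>
  The elementary symmetric polynomial \<open>e\<^sub>k(y\<^sub>1, ..., y\<^sub>n)\<close>, read off from its generating polynomial.
\<close>

definition esym :: "(nat \<Rightarrow> real) \<Rightarrow> nat \<Rightarrow> nat \<Rightarrow> real" where
  "esym y n k = coeff (\<Prod>i=1..n. [:1, y i:]) k"

definition power_sum :: "(nat \<Rightarrow> real) \<Rightarrow> nat \<Rightarrow> nat \<Rightarrow> real" where
  "power_sum y n j = (\<Sum>i=1..n. y i ^ j)"

text \<open>
  The logarithmic derivative of \<open>E = \<Prod> (1 + y\<^sub>i t)\<close> is \<open>\<Sum> y\<^sub>i / (1 + y\<^sub>i t)\<close>, whose Taylor coefficients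
  are the power sums with alternating signs. Comparing coefficients yields Newton's identities.
\<close>

lemma newton_fps:
  fixes y :: "nat \<Rightarrow> real"
  defines "E \<equiv> \<lambda>n. fps_of_poly (\<Prod>i=1..n. [:1, y i:])"
  shows "fps_deriv (E n) = E n * Abs_fps (\<lambda>j. (-1) ^ j * power_sum y n (Suc j))"
proof (induction n)
  case 0
  show ?case by (simp add: E_def power_sum_def fps_eq_iff)
next
  case (Suc n)
  define L where "L = (1 + fps_const (y (Suc n)) * fps_X :: real fps)"
  define G where "G = Abs_fps (\<lambda>j. (-1) ^ j * y (Suc n) ^ Suc j)"
  have E: "E (Suc n) = E n * L"
    by (simp add: E_def L_def fps_of_poly_mult fps_of_poly_pCons)
  have "fps_nth (L * G) k = fps_nth (fps_const (y (Suc n))) k" for k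
    by (cases k) (simp_all add: L_def G_def distrib_right mult.assoc)
  hence LG: "L * G = fps_const (y (Suc n))" by (simp add: fps_eq_iff)
  have P: "Abs_fps (\<lambda>j. (-1) ^ j * power_sum y (Suc n) (Suc j)) =
      Abs_fps (\<lambda>j. (-1) ^ j * power_sum y n (Suc j)) + G"
    by (simp add: fps_eq_iff G_def power_sum_def algebra_simps)
  have "fps_deriv (E (Suc n)) = fps_deriv (E n) * L + E n * (L * G)"
    unfolding E LG by (simp add: L_def algebra_simps)
  also have "\<dots> = E (Suc n) * Abs_fps (\<lambda>j. (-1) ^ j * power_sum y (Suc n) (Suc j))"
    unfolding Suc.IH E P by (simp add: algebra_simps)
  finally show ?case .
qed

lemma newton_identity:
  "real (Suc k) * esym y n (Suc k) =
     (\<Sum>j\<le>k. (-1) ^ j * esym y n (k - j) * power_sum y n (Suc j))"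
proof -
  have "real (Suc k) * esym y n (Suc k) =
      fps_nth (fps_deriv (fps_of_poly (\<Prod>i=1..n. [:1, y i:]))) k"
    by (simp add: esym_def)
  also have "\<dots> = (\<Sum>i=0..k. esym y n i * ((-1) ^ (k - i) * power_sum y n (Suc (k - i))))"
    unfolding newton_fps by (simp add: fps_mult_nth esym_def)
  also have "\<dots> = (\<Sum>j\<le>k. (-1) ^ j * esym y n (k - j) * power_sum y n (Suc j))"
    by (rule sum.reindex_bij_witness[of _ "\<lambda>j. k - j" "\<lambda>i. k - i"]) auto
  finally show ?thesis .
qed

text \<open>
  For centred \<open>y\<^sub>i\<close> of unit variance, the factors \<open>k!\<close> and \<open>n\<^bsup>-k/2\<^esup>\<close> make \<open>e\<^sub>k\<close> comparable with the Hermite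
  polynomial of degree \<open>k\<close> in the normalised sum \<open>(y\<^sub>1 + ... + y\<^sub>n) / sqrt n\<close>.
\<close>

definition esym_scaled :: "(nat \<Rightarrow> real) \<Rightarrow> nat \<Rightarrow> nat \<Rightarrow> real" where
  "esym_scaled y n k = fact k * esym y n k / sqrt (real n) ^ k"

lemma esym_scaled_0: "esym_scaled y n 0 = 1"
proof -
  have "coeff (\<Prod>i=1..n. [:1, y i:]) 0 = poly (\<Prod>i=1..n. [:1, y i:]) 0"
    by (simp add: poly_0_coeff_0)
  also have "\<dots> = 1" by (simp add: poly_prod)
  finally show ?thesis by (simp add: esym_scaled_def esym_def)
qed

lemma esym_scaled_Suc:
  assumes "n > 0"
  shows "esym_scaled y n (Suc k) =
     (\<Sum>j\<le>k. (-1) ^ j * (fact k / fact (k - j)) *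
        (esym_scaled y n (k - j) * (power_sum y n (Suc j) / sqrt (real n) ^ Suc j)))"
proof -
  define s where "s = sqrt (real n)"
  have s: "s \<noteq> 0" using assms by (simp add: s_def)
  have "esym_scaled y n (Suc k) = fact k / s ^ Suc k * (real (Suc k) * esym y n (Suc k))"
    by (simp add: esym_scaled_def s_def)
  also have "\<dots> = (\<Sum>j\<le>k. fact k / s ^ Suc k *
      ((-1) ^ j * esym y n (k - j) * power_sum y n (Suc j)))"
    unfolding newton_identity by (rule sum_distrib_left)
  also have "\<dots> = (\<Sum>j\<le>k. (-1) ^ j * (fact k / fact (k - j)) *
        (esym_scaled y n (k - j) * (power_sum y n (Suc j) / s ^ Suc j)))"
  proof (rule sum.cong)
    fix j assume "j \<in> {..k}"
    hence "s ^ Suc k = s ^ (k - j) * s ^ Suc j"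
      by (simp flip: power_add)
    thus "fact k / s ^ Suc k * ((-1) ^ j * esym y n (k - j) * power_sum y n (Suc j)) =
       (-1) ^ j * (fact k / fact (k - j)) *
        (esym_scaled y n (k - j) * (power_sum y n (Suc j) / s ^ Suc j))"
      using s by (simp add: esym_scaled_def s_def[symmetric] field_simps)
  qed simp
  finally show ?thesis by (simp add: s_def)
qed

lemma higher_pderiv_pcompose_shift:
  fixes p :: "real poly"
  shows "(pderiv ^^ m) (pcompose p [:z, 1:]) = pcompose ((pderiv ^^ m) p) [:z, 1:]"
  by (induction m) (simp_all add: pderiv_pcompose pderiv_pCons)

text \<open>
  Replacing the variable \<open>t\<close> by \<open>z + t\<close> moves \<open>z\<close> to the origin and turns the factors into
  \<open>t + (z - r\<^sub>i)\<close>. The derivative at the origin is then a coefficient of their product, and reversing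
  the order of the coefficients identifies it with an elementary symmetric polynomial. Working with
  shifted roots puts the whole dependence on \<open>x\<close> into the power sums.
\<close>

lemma root_poly_higher_pderiv:
  assumes "l \<le> n"
  shows "poly ((pderiv ^^ (n - l)) (root_poly r n)) z =
           fact (n - l) * esym (\<lambda>i. z - r i) n l"
proof -
  define Q where "Q = (\<Prod>i=1..n. [:z - r i, 1:])"
  have Q: "pcompose (root_poly r n) [:z, 1:] = Q"
    by (simp add: root_poly_def Q_def pcompose_prod pcompose_pCons)
  have deg: "degree Q = n"
    unfolding Q_def by (subst degree_prod_eq_sum_degree) auto
  have "reflect_poly [:u, 1::real:] = [:1, u:]" for u
    by (cases "u = 0") (simp_all add: reflect_poly_def)
  hence "reflect_poly Q = (\<Prod>i=1..n. [:1, z - r i:])"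
    by (simp add: Q_def reflect_poly_prod)
  hence "esym (\<lambda>i. z - r i) n l = coeff (reflect_poly Q) l"
    by (simp add: esym_def)
  also have "\<dots> = coeff Q (n - l)"
    using assms by (simp add: coeff_reflect_poly deg)
  finally have e: "esym (\<lambda>i. z - r i) n l = coeff Q (n - l)" .
  have "poly ((pderiv ^^ (n - l)) (root_poly r n)) z =
      poly ((pderiv ^^ (n - l)) Q) 0"
    by (simp add: Q[symmetric] higher_pderiv_pcompose_shift poly_pcompose)
  also have "\<dots> = fact (n - l) * coeff Q (n - l)"
    by (simp add: poly_0_coeff_0 coeff_higher_pderiv pochhammer_fact)
  finally show ?thesis by (simp add: e)
qed

section \<open>Hermite polynomials\<close>

fun hermite_poly :: "nat \<Rightarrow> real poly" where
  "hermite_poly 0 = 1"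
| "hermite_poly (Suc 0) = [:0, 1:]"
| "hermite_poly (Suc (Suc k)) =
     [:0, 1:] * hermite_poly (Suc k) - smult (real (Suc k)) (hermite_poly k)"

lemma pderiv_hermite_poly:
  "pderiv (hermite_poly (Suc k)) = smult (real (Suc k)) (hermite_poly k)"
proof (induction k rule: hermite_poly.induct)
  case (3 k)
  have "pderiv (hermite_poly (Suc (Suc (Suc k)))) =
    hermite_poly (Suc (Suc k)) + [:0,1:] * pderiv (hermite_poly (Suc (Suc k)))
     - smult (real (Suc (Suc k))) (pderiv (hermite_poly (Suc k)))"
    by (simp only: hermite_poly.simps(3)[of "Suc k"] pderiv_diff pderiv_mult pderiv_smult)
       (simp add: pderiv_pCons)
  also have "\<dots> = smult (real (Suc (Suc (Suc k)))) (hermite_poly (Suc (Suc k)))"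
    unfolding 3 by (rule poly_eq_poly_eq_iff[THEN iffD1, OF ext]) (simp add: algebra_simps)
  finally show ?case .
qed (simp_all add: pderiv_pCons)

lemma hermite_poly_Suc:
  "hermite_poly (Suc k) = [:0, 1:] * hermite_poly k - pderiv (hermite_poly k)"
  by (cases k) (simp_all add: pderiv_hermite_poly del: mult_pCons_left)

lemma hermite_He_eq_poly: "hermite_He l x = poly (hermite_poly l) x"
proof -
  have "(deriv ^^ l) (\<lambda>t. exp (- (t\<^sup>2 / 2))) =
          (\<lambda>t::real. (-1) ^ l * poly (hermite_poly l) t * exp (- (t\<^sup>2 / 2)))"
  proof (induction l)
    case (Suc l)
    show ?case
      unfolding funpow.simps o_def Suc
    proof (rule ext, rule DERIV_imp_deriv)
      fix t :: real
      show "((\<lambda>t. (-1) ^ l * poly (hermite_poly l) t * exp (- (t\<^sup>2 / 2))) has_field_derivative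
         (-1) ^ Suc l * poly (hermite_poly (Suc l)) t * exp (- (t\<^sup>2 / 2))) (at t)"
        unfolding hermite_poly_Suc
        by (rule derivative_eq_intros poly_DERIV refl | simp)+ (simp add: algebra_simps)
    qed
  qed simp
  thus ?thesis by (simp add: hermite_He_def mult_ac flip: exp_add power_mult_distrib)
qed

text \<open>
  Hermite polynomials solve the recursion of lemma \<open>esym_scaled_Suc\<close> for the idealised power sums
  \<open>(s, 1, 0, 0, ...)\<close>: only the terms \<open>j = 0\<close> and \<open>j = 1\<close> survive, and they form the three-term
  recursion.
\<close>

lemma hermite_poly_newton:
  assumes "h (Suc 0) = s" "h 2 = 1" "\<And>j. j \<ge> 3 \<Longrightarrow> h j = (0::real)"
  shows "poly (hermite_poly (Suc k)) s =
     (\<Sum>j\<le>k. (-1) ^ j * (fact k / fact (k - j)) * (poly (hermite_poly (k - j)) s * h (Suc j)))"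
proof (cases k)
  case (Suc m)
  have "(\<Sum>j\<le>k. (-1) ^ j * (fact k / fact (k - j)) * (poly (hermite_poly (k - j)) s * h (Suc j))) =
     (\<Sum>j\<in>{0,1}. (-1) ^ j * (fact k / fact (k - j)) * (poly (hermite_poly (k - j)) s * h (Suc j)))"
    using Suc assms(3) by (intro sum.mono_neutral_right) auto
  also have "\<dots> = poly (hermite_poly (Suc k)) s"
    using Suc assms(1,2) by (simp add: numeral_2_eq_2)
  finally show ?thesis by simp
qed (simp add: assms)

section \<open>Deterministic approximation by Hermite polynomials\<close>

lemma tendsto_zero_mult_bounded:
  fixes f g :: "'c \<Rightarrow> real"
  assumes "(f \<longlongrightarrow> 0) F" "\<forall>\<^sub>F x in F. \<bar>g x\<bar> \<le> B"
  shows "((\<lambda>x. f x * g x) \<longlongrightarrow> 0) F"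
proof (rule Lim_null_comparison)
  show "\<forall>\<^sub>F x in F. norm (f x * g x) \<le> \<bar>f x\<bar> * B"
    using assms(2) by eventually_elim (simp add: abs_mult mult_left_mono)
  show "((\<lambda>x. \<bar>f x\<bar> * B) \<longlongrightarrow> 0) F"
    using tendsto_mult_left_zero[OF tendsto_rabs_zero[OF assms(1)]] by simp
qed

lemma poly_bounded:
  fixes p :: "real poly"
  obtains B where "\<And>s. \<bar>s\<bar> \<le> K \<Longrightarrow> \<bar>poly p s\<bar> \<le> B"
proof -
  have "compact (poly p ` {-K..K})"
    by (intro compact_continuous_image continuous_intros) auto
  then obtain B where "\<And>z. z \<in> poly p ` {-K..K} \<Longrightarrow> norm z \<le> B"
    by (meson bounded_iff compact_imp_bounded)
  thus ?thesis by (intro that[of B]) (auto simp: abs_le_iff)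
qed

text \<open>
  Continuity of the Newton recursion in its coefficients. The first coefficient \<open>q 1\<close> is only assumed
  bounded and need not converge; this is why the conclusion is about a difference, with the
  Hermite polynomial evaluated at the moving point \<open>q 1\<close>.
\<close>

lemma newton_recursion_tendsto_hermite:
  fixes A :: "'c \<Rightarrow> nat \<Rightarrow> real" and q :: "'c \<Rightarrow> nat \<Rightarrow> real"
  assumes A0: "\<And>c. A c 0 = 1"
    and A_Suc: "\<forall>\<^sub>F c in F. \<forall>k. A c (Suc k) =
      (\<Sum>j\<le>k. (-1) ^ j * (fact k / fact (k - j)) * (A c (k - j) * q c (Suc j)))"
    and q1: "\<forall>\<^sub>F c in F. \<bar>q c 1\<bar> \<le> K"
    and q2: "((\<lambda>c. q c 2) \<longlongrightarrow> 1) F"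
    and q3: "\<And>j. j \<ge> 3 \<Longrightarrow> j \<le> l \<Longrightarrow> ((\<lambda>c. q c j) \<longlongrightarrow> 0) F"
    and kl: "k \<le> l"
  shows "((\<lambda>c. A c k - poly (hermite_poly k) (q c 1)) \<longlongrightarrow> 0) F"
  using kl
proof (induction k rule: less_induct)
  case (less k)
  show ?case
  proof (cases k)
    case 0
    thus ?thesis by (simp add: A0)
  next
    case (Suc m)
    \<comment> \<open>The idealised power sums at the point \<open>q c 1\<close>.\<close>
    define h where "h c j = (if j = 1 then q c 1 else if j = 2 then 1 else 0 :: real)" for c and j :: nat
    define H where "H c i = poly (hermite_poly i) (q c 1)" for c i
    have h: "((\<lambda>c. q c (Suc j) - h c (Suc j)) \<longlongrightarrow> 0) F" if "Suc j \<le> k" for j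
    proof -
      consider "j = 0" | "j = 1" | "Suc j \<ge> 3" by linarith
      thus ?thesis
      proof cases
        case 2
        thus ?thesis using q2 by (simp add: h_def LIM_zero numeral_2_eq_2)
      next
        case 3
        thus ?thesis using q3[OF 3] that less.prems by (auto simp: h_def)
      qed (simp add: h_def)
    qed
    have h_bd: "\<forall>\<^sub>F c in F. \<bar>h c j\<bar> \<le> max K 1" for j
      using q1 by eventually_elim (auto simp: h_def)
    have lim_term: "((\<lambda>c. A c i * q c (Suc j) - H c i * h c (Suc j)) \<longlongrightarrow> 0) F" if "i < k" "Suc j \<le> k" for i j
    proof -
      obtain B where B: "\<And>s. \<bar>s\<bar> \<le> K \<Longrightarrow> \<bar>poly (hermite_poly i) s\<bar> \<le> B"
        using poly_bounded by blast
      have AH: "((\<lambda>c. A c i - H c i) \<longlongrightarrow> 0) F"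
        using less.IH[OF that(1)] less.prems that(1) by (simp add: H_def)
      have "((\<lambda>c. (A c i - H c i) * (q c (Suc j) - h c (Suc j)) +
              (A c i - H c i) * h c (Suc j) + (q c (Suc j) - h c (Suc j)) * H c i) \<longlongrightarrow> 0) F"
        by (rule tendsto_eq_intros AH h[OF that(2)] tendsto_zero_mult_bounded[OF AH h_bd]
              tendsto_zero_mult_bounded[OF h[OF that(2)], where B = B] refl)+
           (use q1 B in \<open>auto simp: H_def elim: eventually_mono\<close>)
      thus ?thesis by (simp add: algebra_simps)
    qed
    have "((\<lambda>c. \<Sum>j\<le>m. (-1) ^ j * (fact m / fact (m - j)) *
             (A c (m - j) * q c (Suc j) - H c (m - j) * h c (Suc j))) \<longlongrightarrow> 0) F"
      by (intro tendsto_null_sum tendsto_mult_right_zero lim_term) (use Suc in auto)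
    moreover have "\<forall>\<^sub>F c in F. (\<Sum>j\<le>m. (-1) ^ j * (fact m / fact (m - j)) *
             (A c (m - j) * q c (Suc j) - H c (m - j) * h c (Suc j))) =
             A c k - poly (hermite_poly k) (q c 1)"
      using A_Suc
    proof eventually_elim
      case (elim c)
      have "poly (hermite_poly k) (q c 1) =
        (\<Sum>j\<le>m. (-1) ^ j * (fact m / fact (m - j)) * (H c (m - j) * h c (Suc j)))"
        unfolding Suc H_def by (rule hermite_poly_newton) (auto simp: h_def)
      thus ?case
        using elim unfolding Suc by (simp add: sum_subtractf right_diff_distrib)
    qed
    ultimately show ?thesis by (rule Lim_transform_eventually)
  qed
qed

text \<open>
  The next three lemmas compare the normalised power sums of the shifted numbers \<open>x / sqrt n - r\<^sub>i\<close> with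
  those of the \<open>r\<^sub>i\<close>. The shift is felt only in the first power sum; in the higher ones it
  contributes terms that vanish as \<open>n\<close> grows.
\<close>

lemma power_sum_shift_1:
  assumes "n > 0"
  shows "power_sum (\<lambda>i. x / sqrt (real n) - r i) n 1 / sqrt (real n) =
           x - power_sum r n 1 / sqrt (real n)"
proof -
  have "power_sum (\<lambda>i. x / sqrt (real n) - r i) n 1 = x * (real n / sqrt (real n)) - power_sum r n 1"
    by (simp add: power_sum_def sum_subtractf)
  also have "real n / sqrt (real n) = sqrt (real n)" by (simp add: real_div_sqrt)
  finally show ?thesis using assms by (simp add: diff_divide_distrib)
qed

lemma power_sum_shift_2:
  assumes "n > 0"
  shows "power_sum (\<lambda>i. x / sqrt (real n) - r i) n 2 / sqrt (real n) ^ 2 =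
           x\<^sup>2 / real n - 2 * x * (power_sum r n 1 / sqrt (real n)) / real n + power_sum r n 2 / real n"
proof -
  have "power_sum (\<lambda>i. x / sqrt (real n) - r i) n 2 =
     x\<^sup>2 - 2 * (x / sqrt (real n)) * power_sum r n 1 + power_sum r n 2"
    using assms
    by (simp add: power_sum_def power2_diff sum.distrib sum_subtractf sum_distrib_left
        power_divide sum_divide_distrib mult_ac)
  thus ?thesis using assms by (simp add: field_simps)
qed

lemma power_sum_shift_bound:
  assumes "n > 0" "j > 0"
  shows "\<bar>power_sum (\<lambda>i. x / sqrt (real n) - r i) n j / sqrt (real n) ^ j\<bar> \<le>
     2 ^ j * (\<bar>x\<bar> ^ j / real n ^ (j - 1) + power_sum (\<lambda>i. \<bar>r i\<bar>) n j / sqrt (real n) ^ j)"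
proof -
  define s where "s = sqrt (real n)"
  have s: "s > 0" "s ^ 2 = real n" using assms by (simp_all add: s_def)
  have bd: "\<bar>u - v\<bar> ^ j \<le> 2 ^ j * (\<bar>u\<bar> ^ j + \<bar>v\<bar> ^ j)" for u v :: real
  proof -
    have "\<bar>u - v\<bar> ^ j \<le> (2 * max \<bar>u\<bar> \<bar>v\<bar>) ^ j" by (intro power_mono) auto
    also have "\<dots> \<le> 2 ^ j * (\<bar>u\<bar> ^ j + \<bar>v\<bar> ^ j)"
      by (auto simp: power_mult_distrib max_def)
    finally show ?thesis .
  qed
  have "\<bar>power_sum (\<lambda>i. x / s - r i) n j\<bar> \<le> (\<Sum>i=1..n. \<bar>x / s - r i\<bar> ^ j)"
    unfolding power_sum_def by (rule order.trans[OF sum_abs]) (simp add: power_abs)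
  also have "\<dots> \<le> (\<Sum>i=1..n. 2 ^ j * (\<bar>x / s\<bar> ^ j + \<bar>r i\<bar> ^ j))"
    by (intro sum_mono bd)
  also have "\<dots> = 2 ^ j * (real n * \<bar>x\<bar> ^ j / s ^ j + power_sum (\<lambda>i. \<bar>r i\<bar>) n j)"
    using s by (simp add: power_sum_def sum.distrib power_divide flip: sum_distrib_left)
  finally have "\<bar>power_sum (\<lambda>i. x / s - r i) n j\<bar> / s ^ j \<le>
      2 ^ j * (real n * \<bar>x\<bar> ^ j / s ^ j + power_sum (\<lambda>i. \<bar>r i\<bar>) n j) / s ^ j"
    using s by (intro divide_right_mono) auto
  also have "\<dots> = 2 ^ j * (\<bar>x\<bar> ^ j * (real n / (s ^ j * s ^ j)) + power_sum (\<lambda>i. \<bar>r i\<bar>) n j / s ^ j)"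
    using s by (simp add: field_simps)
  also have "s ^ j * s ^ j = real n ^ j"
    by (simp add: s(2)[symmetric] power_mult_distrib power2_eq_square)
  also have "real n / real n ^ j = 1 / real n ^ (j - 1)"
    using assms by (simp add: field_simps power_eq_if)
  finally show ?thesis using s by (simp add: s_def abs_divide)
qed

lemma esym_scaled_shift_tendsto_hermite:
  fixes N :: "nat \<Rightarrow> nat" and x :: "nat \<Rightarrow> real" and r :: "nat \<Rightarrow> nat \<Rightarrow> real"
  assumes N: "filterlim N at_top sequentially"
    and x: "\<And>m. \<bar>x m\<bar> \<le> C"
    and S: "\<And>m. \<bar>power_sum (r m) (N m) 1 / sqrt (real (N m))\<bar> \<le> K"
    and r2: "(\<lambda>m. power_sum (r m) (N m) 2 / real (N m)) \<longlonglongrightarrow> 1"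
    and r3: "\<And>j. j \<ge> 3 \<Longrightarrow> j \<le> l \<Longrightarrow>
      (\<lambda>m. power_sum (\<lambda>i. \<bar>r m i\<bar>) (N m) j / sqrt (real (N m)) ^ j) \<longlonglongrightarrow> 0"
  shows "(\<lambda>m. esym_scaled (\<lambda>i. x m / sqrt (real (N m)) - r m i) (N m) l -
     poly (hermite_poly l) (x m - power_sum (r m) (N m) 1 / sqrt (real (N m)))) \<longlonglongrightarrow> 0"
proof -
  define y where "y m i = x m / sqrt (real (N m)) - r m i" for m i
  define q where "q m j = power_sum (y m) (N m) j / sqrt (real (N m)) ^ j" for m j
  define T where "T m = power_sum (r m) (N m) 1 / sqrt (real (N m))" for m
  have N0: "\<forall>\<^sub>F m in sequentially. N m > 0"
    by (rule eventually_compose_filterlim[OF eventually_gt_at_top N])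
  have inv: "(\<lambda>m. 1 / real (N m)) \<longlonglongrightarrow> 0"
    using filterlim_compose[OF lim_1_over_n N] by simp
  have q1: "\<forall>\<^sub>F m in sequentially. q m 1 = x m - T m"
    using N0 by eventually_elim (simp only: q_def y_def[abs_def] T_def power_sum_shift_1 power_one_right)
  have "(\<lambda>m. esym_scaled (y m) (N m) l - poly (hermite_poly l) (q m 1)) \<longlonglongrightarrow> 0"
  proof (rule newton_recursion_tendsto_hermite[where K = "C + K" and l = l])
    show "\<forall>\<^sub>F m in sequentially. \<forall>k. esym_scaled (y m) (N m) (Suc k) =
       (\<Sum>j\<le>k. (-1) ^ j * (fact k / fact (k - j)) * (esym_scaled (y m) (N m) (k - j) * q m (Suc j)))"
      using N0 by eventually_elim (simp add: esym_scaled_Suc q_def)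
    show "\<forall>\<^sub>F m in sequentially. \<bar>q m 1\<bar> \<le> C + K"
      using q1
    proof eventually_elim
      case (elim m)
      thus ?case using x[of m] S[of m, folded T_def] by linarith
    qed
    have "(\<lambda>m. 1 / real (N m) * (x m)\<^sup>2 - 1 / real (N m) * (2 * x m * T m) +
             power_sum (r m) (N m) 2 / real (N m)) \<longlonglongrightarrow> 0 - 0 + 1"
    proof (intro tendsto_add tendsto_diff r2)
      show "(\<lambda>m. 1 / real (N m) * (x m)\<^sup>2) \<longlonglongrightarrow> 0"
      proof (rule tendsto_zero_mult_bounded[OF inv])
        show "\<forall>\<^sub>F m in sequentially. \<bar>(x m)\<^sup>2\<bar> \<le> C\<^sup>2"
          using x by (auto intro!: always_eventually simp: abs_le_square_iff power2_abs)
             (metis abs_ge_zero order_trans power2_abs power_mono)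
      qed
      show "(\<lambda>m. 1 / real (N m) * (2 * x m * T m)) \<longlonglongrightarrow> 0"
      proof (rule tendsto_zero_mult_bounded[OF inv])
        have "\<bar>x m\<bar> * \<bar>T m\<bar> \<le> C * K" for m
          using x[of m] S[of m] by (intro mult_mono) (auto simp: T_def)
        thus "\<forall>\<^sub>F m in sequentially. \<bar>2 * x m * T m\<bar> \<le> 2 * (C * K)"
          by (auto simp: abs_mult)
      qed
    qed
    moreover have "\<forall>\<^sub>F m in sequentially. 1 / real (N m) * (x m)\<^sup>2 - 1 / real (N m) * (2 * x m * T m) +
             power_sum (r m) (N m) 2 / real (N m) = q m 2"
      using N0 unfolding q_def y_def T_def
      by eventually_elim (subst power_sum_shift_2, simp_all)
    ultimately show "(\<lambda>m. q m 2) \<longlonglongrightarrow> 1"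
      using Lim_transform_eventually by force
  next
    fix j :: nat assume j: "j \<ge> 3" "j \<le> l"
    have xC: "\<bar>\<bar>x m\<bar> ^ j\<bar> \<le> C ^ j" for m using x[of m] by (simp add: power_mono)
    have "(\<lambda>m. (1 / real (N m)) ^ (j - 1)) \<longlonglongrightarrow> 0"
      by (rule tendsto_null_power[OF inv]) (use j in auto)
    from tendsto_zero_mult_bounded[OF this always_eventually[rule_format, OF xC]]
    have "(\<lambda>m. \<bar>x m\<bar> ^ j / real (N m) ^ (j - 1)) \<longlonglongrightarrow> 0"
      by (simp add: power_one_over)
    hence bd: "(\<lambda>m. 2 ^ j * (\<bar>x m\<bar> ^ j / real (N m) ^ (j - 1) +
        power_sum (\<lambda>i. \<bar>r m i\<bar>) (N m) j / sqrt (real (N m)) ^ j)) \<longlonglongrightarrow> 0"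
      by (intro tendsto_mult_right_zero tendsto_add_zero r3 j)
    show "(\<lambda>m. q m j) \<longlonglongrightarrow> 0"
    proof (rule Lim_null_comparison[OF _ bd])
      show "\<forall>\<^sub>F m in sequentially. norm (q m j) \<le> 2 ^ j * (\<bar>x m\<bar> ^ j / real (N m) ^ (j - 1) +
        power_sum (\<lambda>i. \<bar>r m i\<bar>) (N m) j / sqrt (real (N m)) ^ j)"
        using N0
      proof eventually_elim
        case (elim m)
        show ?case
          using power_sum_shift_bound[OF elim, of j "x m" "r m"] j by (simp add: q_def y_def[abs_def])
      qed
    qed
  qed (simp_all add: esym_scaled_0)
  moreover have "\<forall>\<^sub>F m in sequentially.
      esym_scaled (y m) (N m) l - poly (hermite_poly l) (q m 1) =
      esym_scaled (y m) (N m) l - poly (hermite_poly l) (x m - T m)"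
    using q1 by eventually_elim simp
  ultimately have "(\<lambda>m. esym_scaled (y m) (N m) l - poly (hermite_poly l) (x m - T m)) \<longlonglongrightarrow> 0"
    by (rule Lim_transform_eventually)
  thus ?thesis by (simp add: y_def[abs_def] T_def)
qed

text \<open>
  A quantitative form that can be applied at a single sample point. Its uniformity in \<open>n\<close>, \<open>x\<close> and \<open>r\<close>
  follows from the sequential version above: a failure for every \<open>\<delta> = 1 / (m + 1)\<close> would produce a
  sequence of configurations contradicting it. The hypothesis \<open>1 \<le> \<delta> n\<close> makes \<open>n\<close> tend to infinity
  along such a sequence.
\<close>

lemma esym_scaled_near_hermite:
  fixes C K \<eta> :: real and l :: nat
  assumes "\<eta> > 0"
  obtains \<delta> :: real where "\<delta> > 0"
    "\<And>(n::nat) x r. 1 \<le> \<delta> * real n \<Longrightarrow> \<bar>x\<bar> \<le> C \<Longrightarrow>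
       \<bar>power_sum r n 1 / sqrt (real n)\<bar> \<le> K \<Longrightarrow>
       \<bar>power_sum r n 2 / real n - 1\<bar> \<le> \<delta> \<Longrightarrow>
       (\<And>j. j \<ge> 3 \<Longrightarrow> j \<le> l \<Longrightarrow> power_sum (\<lambda>i. \<bar>r i\<bar>) n j / sqrt (real n) ^ j \<le> \<delta>) \<Longrightarrow>
       \<bar>esym_scaled (\<lambda>i. x / sqrt (real n) - r i) n l -
          poly (hermite_poly l) (x - power_sum r n 1 / sqrt (real n))\<bar> \<le> \<eta>"
proof -
  define good where "good \<delta> n x r \<longleftrightarrow> 1 \<le> \<delta> * real n \<and> \<bar>x\<bar> \<le> C \<and>
       \<bar>power_sum r n 1 / sqrt (real n)\<bar> \<le> K \<and> \<bar>power_sum r n 2 / real n - 1\<bar> \<le> \<delta> \<and>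
       (\<forall>j. j \<ge> 3 \<longrightarrow> j \<le> l \<longrightarrow> power_sum (\<lambda>i. \<bar>r i\<bar>) n j / sqrt (real n) ^ j \<le> \<delta>)"
    for \<delta> :: real and n x r
  define err where "err n x r = \<bar>esym_scaled (\<lambda>i. x / sqrt (real n) - r i) n l -
          poly (hermite_poly l) (x - power_sum r n 1 / sqrt (real n))\<bar>" for n x r
  have "\<exists>\<delta>>0. \<forall>n x r. good \<delta> n x r \<longrightarrow> err n x r \<le> \<eta>"
  proof (rule ccontr)
    assume contra: "\<not> ?thesis"
    define d where "d m = 1 / real (Suc m)" for m
    have d: "d \<longlonglongrightarrow> 0" "d m > 0" for m
      unfolding d_def using LIMSEQ_inverse_real_of_nat by (simp_all add: inverse_eq_divide)
    have "\<forall>m. \<exists>n x r. good (d m) n x r \<and> err n x r > \<eta>"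
      using contra d(2) by (meson not_le)
    then obtain N x r where g: "\<And>m. good (d m) (N m) (x m) (r m)"
      and e: "\<And>m. err (N m) (x m) (r m) > \<eta>" by metis
    have "(\<lambda>m. esym_scaled (\<lambda>i. x m / sqrt (real (N m)) - r m i) (N m) l -
     poly (hermite_poly l) (x m - power_sum (r m) (N m) 1 / sqrt (real (N m)))) \<longlonglongrightarrow> 0"
    proof (rule esym_scaled_shift_tendsto_hermite)
      have "m \<le> N m" for m
      proof -
        have "real (Suc m) \<le> real (N m)"
          using g[of m] by (simp add: good_def d_def field_simps)
        thus ?thesis by simp
      qed
      thus "filterlim N at_top sequentially"
        by (intro filterlim_at_top_mono[OF filterlim_ident]) auto
      show "\<bar>x m\<bar> \<le> C" "\<bar>power_sum (r m) (N m) 1 / sqrt (real (N m))\<bar> \<le> K" for m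
        using g[of m] by (simp_all add: good_def)
      have "(\<lambda>m. power_sum (r m) (N m) 2 / real (N m) - 1) \<longlonglongrightarrow> 0"
        by (rule Lim_null_comparison[OF _ d(1)]) (use g in \<open>simp add: good_def\<close>)
      thus "(\<lambda>m. power_sum (r m) (N m) 2 / real (N m)) \<longlonglongrightarrow> 1"
        by (rule LIM_zero_cancel)
      show "(\<lambda>m. power_sum (\<lambda>i. \<bar>r m i\<bar>) (N m) j / sqrt (real (N m)) ^ j) \<longlonglongrightarrow> 0"
        if "j \<ge> 3" "j \<le> l" for j
      proof (rule Lim_null_comparison[OF _ d(1)])
        have "power_sum (\<lambda>i. \<bar>r m i\<bar>) (N m) j \<ge> 0" for m
          by (simp add: power_sum_def sum_nonneg)
        thus "\<forall>\<^sub>F m in sequentially.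
            norm (power_sum (\<lambda>i. \<bar>r m i\<bar>) (N m) j / sqrt (real (N m)) ^ j) \<le> d m"
          using g that by (simp add: good_def)
      qed
    qed
    hence "\<forall>\<^sub>F m in sequentially. err (N m) (x m) (r m) < \<eta>"
      using assms by (auto simp: tendsto_iff err_def)
    then obtain m where "err (N m) (x m) (r m) < \<eta>"
      by (meson eventually_happens trivial_limit_sequentially)
    thus False using e[of m] by simp
  qed
  thus ?thesis using that unfolding good_def err_def by metis
qed

lemma falling_factorial_ratio_tendsto:
  "(\<lambda>n. real n ^ l * fact (n - l) / fact n) \<longlonglongrightarrow> 1"
proof (induction l)
  case (Suc l)
  have "(\<lambda>n. real n / (real n - real l)) \<longlonglongrightarrow> 1" by real_asymp
  from tendsto_mult[OF Suc.IH this]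
  have "(\<lambda>n. real n ^ l * fact (n - l) / fact n * (real n / (real n - real l))) \<longlonglongrightarrow> 1" by simp
  moreover have "\<forall>\<^sub>F n in sequentially. real n ^ l * fact (n - l) / fact n * (real n / (real n - real l)) =
      real n ^ Suc l * fact (n - Suc l) / fact n"
    using eventually_gt_at_top[of l]
  proof eventually_elim
    case (elim n)
    hence "n - l = Suc (n - Suc l)" by simp
    hence "(fact (n - l) :: real) = (real n - real l) * fact (n - Suc l)"
      using elim by (simp add: fact_reduce of_nat_diff)
    moreover have "real n - real l \<noteq> 0" using elim by simp
    ultimately show ?case by (simp add: divide_simps)
  qed
  ultimately show ?case by (rule Lim_transform_eventually)
qed (simp)

section \<open>Where a polynomial is small\<close>

text \<open>
  Induction on the degree, splitting off one root \<open>w\<close> at a time: if \<open>|z - w| |q(z)| \<le> t \<eta>\<close>, then either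
  \<open>|z - w| < t\<close> or \<open>|q(z)| \<le> \<eta>\<close>. The finite set consists of the roots and does not depend on \<open>t\<close>;
  this matters because the number of intervals must stay fixed while their length shrinks.
\<close>

lemma complex_poly_small_near_finite_set:
  fixes p :: "complex poly"
  assumes "p \<noteq> 0"
  shows "\<exists>R. finite R \<and> (\<forall>t>0. \<exists>\<eta>>0. \<forall>z. norm (poly p z) \<le> \<eta> \<longrightarrow> (\<exists>\<rho>\<in>R. norm (z - \<rho>) < t))"
  using assms
proof (induction "degree p" arbitrary: p rule: less_induct)
  case (less p)
  show ?case
  proof (cases "degree p = 0")
    case True
    then obtain c where c: "p = [:c:]" by (rule degree_eq_zeroE)
    hence "norm c / 2 > 0" "\<not> norm c \<le> norm c / 2" using less.prems by auto
    hence "\<exists>\<eta>>0. \<not> norm c \<le> \<eta>" by blast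
    thus ?thesis by (intro exI[of _ "{}"]) (auto simp: c)
  next
    case False
    then obtain w where "poly p w = 0"
      using fundamental_theorem_of_algebra constant_degree by metis
    then obtain q where p: "p = [:-w, 1:] * q"
      by (auto simp: poly_eq_0_iff_dvd dvd_def)
    have q: "q \<noteq> 0" using less.prems p by auto
    have "degree p = Suc (degree q)"
      unfolding p using q by (subst degree_mult_eq) auto
    then obtain R where R: "finite R"
      "\<And>t. t > 0 \<Longrightarrow> \<exists>\<eta>>0. \<forall>z. norm (poly q z) \<le> \<eta> \<longrightarrow> (\<exists>\<rho>\<in>R. norm (z - \<rho>) < t)"
      using less.hyps[of q] q by auto
    have "\<exists>\<eta>>0. \<forall>z. norm (poly p z) \<le> \<eta> \<longrightarrow> (\<exists>\<rho>\<in>insert w R. norm (z - \<rho>) < t)"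
      if t: "t > 0" for t :: real
    proof -
      obtain \<eta> where \<eta>: "\<eta> > 0" "\<And>z. norm (poly q z) \<le> \<eta> \<Longrightarrow> \<exists>\<rho>\<in>R. norm (z - \<rho>) < t"
        using R(2)[OF t] by blast
      have "\<exists>\<rho>\<in>insert w R. norm (z - \<rho>) < t" if z: "norm (poly p z) \<le> t * \<eta>" for z
      proof (cases "norm (z - w) < t")
        case False
        have "t * norm (poly q z) \<le> norm (z - w) * norm (poly q z)"
          using False by (intro mult_right_mono) auto
        also have "\<dots> = norm (poly p z)" by (simp add: p flip: norm_mult) (simp add: algebra_simps)
        finally have "norm (poly q z) \<le> \<eta>"
          using z t by (meson mult_le_cancel_left_pos order_trans)
        thus ?thesis using \<eta>(2) by blast
      qed auto
      thus ?thesis using t \<eta>(1) by (intro exI[of _ "t * \<eta>"]) auto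
    qed
    thus ?thesis using R(1) by (intro exI[of _ "insert w R"]) blast
  qed
qed

text \<open>
  For real arguments the real parts of the complex roots serve as centres, since
  \<open>|y - Re \<rho>| \<le> |y - \<rho>|\<close>.
\<close>

lemma poly_small_near_finite_set:
  fixes p :: "real poly"
  assumes "p \<noteq> 0"
  obtains R where "finite R"
    "\<And>t. t > 0 \<Longrightarrow> \<exists>\<eta>>0. \<forall>y. \<bar>poly p y\<bar> \<le> \<eta> \<longrightarrow> (\<exists>\<rho>\<in>R. \<bar>y - \<rho>\<bar> < t)"
proof -
  define P where "P = map_poly complex_of_real p"
  have "P \<noteq> 0" using assms by (simp add: P_def map_poly_eq_0_iff)
  then obtain R where R: "finite R" and
    near: "\<And>t. t > 0 \<Longrightarrow> \<exists>\<eta>>0. \<forall>z. norm (poly P z) \<le> \<eta> \<longrightarrow> (\<exists>\<rho>\<in>R. norm (z - \<rho>) < t)"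
    using complex_poly_small_near_finite_set by blast
  have P: "norm (poly P (of_real y)) = \<bar>poly p y\<bar>" for y
  proof -
    have "poly P (of_real y) = of_real (poly p y)"
      unfolding P_def by (induction p) (auto simp: map_poly_pCons)
    thus ?thesis by simp
  qed
  show ?thesis
  proof (rule that[of "Re ` R"])
    show "finite (Re ` R)" using R by simp
    fix t :: real assume "t > 0"
    from near[OF this] obtain \<eta> where \<eta>: "\<eta> > 0"
      "\<And>z. norm (poly P z) \<le> \<eta> \<Longrightarrow> \<exists>\<rho>\<in>R. norm (z - \<rho>) < t" by blast
    have "\<exists>\<rho>\<in>Re ` R. \<bar>y - \<rho>\<bar> < t" if y: "\<bar>poly p y\<bar> \<le> \<eta>" for y
    proof -
      obtain \<rho> where "\<rho> \<in> R" "norm (of_real y - \<rho>) < t" using \<eta>(2)[of "of_real y"] y P[of y] by auto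
      moreover have "\<bar>y - Re \<rho>\<bar> \<le> norm (of_real y - \<rho>)"
        using abs_Re_le_cmod[of "of_real y - \<rho>"] by simp
      ultimately show ?thesis by force
    qed
    thus "\<exists>\<eta>>0. \<forall>y. \<bar>poly p y\<bar> \<le> \<eta> \<longrightarrow> (\<exists>\<rho>\<in>Re ` R. \<bar>y - \<rho>\<bar> < t)" using \<eta>(1) by blast
  qed
qed

lemma hermite_poly_neq_0: "hermite_poly l \<noteq> 0"
proof (induction l)
  case (Suc l)
  have "pderiv (hermite_poly (Suc l)) \<noteq> 0" by (simp add: pderiv_hermite_poly Suc)
  thus ?case by auto
qed simp

section \<open>Probability of short intervals and second moments\<close>

text \<open>
  Uniformity over the centres \<open>y\<close> is needed because they depend on \<open>x\<close>. The limiting distribution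
  function is uniformly continuous on compact sets, and finitely many intervals of twice the length
  cover all intervals in question, so that pointwise convergence of the distribution functions at
  finitely many points suffices.
\<close>

lemma weak_conv_small_ball:
  fixes \<mu> :: "nat \<Rightarrow> real measure" and \<nu> :: "real measure"
  assumes conv: "weak_conv_m \<mu> \<nu>" and "\<And>n. real_distribution (\<mu> n)" and "real_distribution \<nu>"
    and atomless: "\<And>x. measure \<nu> {x} = 0" and e: "e > 0"
  obtains t where "t > 0" "\<forall>\<^sub>F n in sequentially. \<forall>y\<in>{c..d}. measure (\<mu> n) {y - t<..<y + t} < e"
proof -
  interpret \<nu>: real_distribution \<nu> by fact
  interpret \<mu>: real_distribution "\<mu> n" for n by fact
  have cont: "isCont (cdf \<nu>) x" for x using atomless by (simp add: \<nu>.isCont_cdf)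
  hence lim: "(\<lambda>n. cdf (\<mu> n) x) \<longlonglongrightarrow> cdf \<nu> x" for x
    using conv by (simp add: weak_conv_m_def weak_conv_def)
  have "uniformly_continuous_on {c-1..d+1} (cdf \<nu>)"
    using cont by (intro compact_uniformly_continuous continuous_at_imp_continuous_on) auto
  then obtain s where s: "s > 0" "\<And>u v. u \<in> {c-1..d+1} \<Longrightarrow> v \<in> {c-1..d+1} \<Longrightarrow> dist u v < s \<Longrightarrow>
      dist (cdf \<nu> u) (cdf \<nu> v) < e"
    using e unfolding uniformly_continuous_on_def by metis
  define t where "t = min 1 s / 5"
  have t: "t > 0" "2 * t \<le> 1" "4 * t < s" using s(1) by (auto simp: t_def min_def)
  have "{c..d} \<subseteq> (\<Union>y\<in>{c..d}. ball y t)" using t by auto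
  then obtain Y where Y: "Y \<subseteq> {c..d}" "finite Y" "{c..d} \<subseteq> (\<Union>y\<in>Y. ball y t)"
    using compactE_image[of "{c..d}" "{c..d}" "\<lambda>y. ball y t"] by auto
  have "\<forall>\<^sub>F n in sequentially. \<forall>y\<in>Y. cdf (\<mu> n) (y + 2 * t) - cdf (\<mu> n) (y - 2 * t) < e"
  proof (intro eventually_ball_finite Y(2) ballI)
    fix y assume "y \<in> Y"
    hence "dist (cdf \<nu> (y + 2 * t)) (cdf \<nu> (y - 2 * t)) < e"
      using Y t by (intro s(2)) (auto simp: dist_real_def)
    hence "cdf \<nu> (y + 2 * t) - cdf \<nu> (y - 2 * t) < e" by (simp add: dist_real_def)
    thus "\<forall>\<^sub>F n in sequentially. cdf (\<mu> n) (y + 2 * t) - cdf (\<mu> n) (y - 2 * t) < e"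
      by (rule order_tendstoD(2)[OF tendsto_diff[OF lim lim]])
  qed
  hence "\<forall>\<^sub>F n in sequentially. \<forall>z\<in>{c..d}. measure (\<mu> n) {z - t<..<z + t} < e"
  proof eventually_elim
    case (elim n)
    show ?case
    proof
      fix z assume "z \<in> {c..d}"
      then obtain y where y: "y \<in> Y" "\<bar>y - z\<bar> < t" using Y(3) by (auto simp: dist_real_def)
      have "measure (\<mu> n) {z - t<..<z + t} \<le> measure (\<mu> n) {y - 2 * t<..y + 2 * t}"
        using y(2) by (intro \<mu>.finite_measure_mono) auto
      also have "\<dots> = cdf (\<mu> n) (y + 2 * t) - cdf (\<mu> n) (y - 2 * t)"
        using t by (intro \<mu>.cdf_diff_eq[symmetric]) auto
      also have "\<dots> < e" using elim y(1) by blast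
      finally show "measure (\<mu> n) {z - t<..<z + t} < e" .
    qed
  qed
  thus ?thesis using that t(1) by blast
qed

text \<open>
  The off-diagonal products in the expanded square have mean zero by independence.
\<close>

lemma (in prob_space) second_moment_sum_indep:
  fixes Y :: "'i \<Rightarrow> 'a \<Rightarrow> real"
  assumes indep: "indep_vars (\<lambda>_. borel) Y I" and "finite I"
    and sq: "\<And>i. i \<in> I \<Longrightarrow> integrable M (\<lambda>\<omega>. (Y i \<omega>)\<^sup>2)"
    and mean: "\<And>i. i \<in> I \<Longrightarrow> expectation (Y i) = 0"
  shows "integrable M (\<lambda>\<omega>. (\<Sum>i\<in>I. Y i \<omega>)\<^sup>2)"
    "expectation (\<lambda>\<omega>. (\<Sum>i\<in>I. Y i \<omega>)\<^sup>2) = (\<Sum>i\<in>I. expectation (\<lambda>\<omega>. (Y i \<omega>)\<^sup>2))"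
proof -
  have rv: "random_variable borel (Y i)" if "i \<in> I" for i
    using indep that unfolding indep_vars_def2 by simp
  have int: "integrable M (Y i)" if "i \<in> I" for i
    by (rule square_integrable_imp_integrable[OF rv[OF that] sq[OF that]])
  have prod: "integrable M (\<lambda>\<omega>. Y i \<omega> * Y j \<omega>) \<and>
      expectation (\<lambda>\<omega>. Y i \<omega> * Y j \<omega>) = (if i = j then expectation (\<lambda>\<omega>. (Y i \<omega>)\<^sup>2) else 0)"
    if "i \<in> I" "j \<in> I" for i j
  proof (cases "i = j")
    case True
    thus ?thesis using sq that by (simp add: power2_eq_square)
  next
    case False
    have ij: "indep_vars (\<lambda>_. borel) Y {i, j}"
      using that by (intro indep_vars_subset[OF indep]) auto
    have "integrable M (\<lambda>\<omega>. \<Prod>k\<in>{i, j}. Y k \<omega>)"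
      by (rule indep_vars_integrable[OF _ ij]) (use int that in auto)
    moreover have "expectation (\<lambda>\<omega>. \<Prod>k\<in>{i, j}. Y k \<omega>) = (\<Prod>k\<in>{i, j}. expectation (Y k))"
      by (rule indep_vars_lebesgue_integral[OF _ ij]) (use int that in auto)
    ultimately show ?thesis using that mean False by simp
  qed
  have expand: "(\<Sum>i\<in>I. Y i \<omega>)\<^sup>2 = (\<Sum>i\<in>I. \<Sum>j\<in>I. Y i \<omega> * Y j \<omega>)" for \<omega>
    by (simp add: power2_eq_square sum_product)
  show "integrable M (\<lambda>\<omega>. (\<Sum>i\<in>I. Y i \<omega>)\<^sup>2)"
    unfolding expand using prod by auto
  have "expectation (\<lambda>\<omega>. (\<Sum>i\<in>I. Y i \<omega>)\<^sup>2) =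
      (\<Sum>i\<in>I. \<Sum>j\<in>I. if i = j then expectation (\<lambda>\<omega>. (Y i \<omega>)\<^sup>2) else 0)"
    unfolding expand using prod by (simp add: Bochner_Integration.integral_sum)
  also have "\<dots> = (\<Sum>i\<in>I. expectation (\<lambda>\<omega>. (Y i \<omega>)\<^sup>2))"
    using \<open>finite I\<close> by (simp add: sum.delta)
  finally show "expectation (\<lambda>\<omega>. (\<Sum>i\<in>I. Y i \<omega>)\<^sup>2) = (\<Sum>i\<in>I. expectation (\<lambda>\<omega>. (Y i \<omega>)\<^sup>2))" .
qed

lemma (in prob_space) prob_abs_sum_indep_gt:
  fixes Y :: "'i \<Rightarrow> 'a \<Rightarrow> real"
  assumes indep: "indep_vars (\<lambda>_. borel) Y I" and "finite I"
    and sq: "\<And>i. i \<in> I \<Longrightarrow> integrable M (\<lambda>\<omega>. (Y i \<omega>)\<^sup>2)"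
    and mean: "\<And>i. i \<in> I \<Longrightarrow> expectation (Y i) = 0"
    and mom: "\<And>i. i \<in> I \<Longrightarrow> expectation (\<lambda>\<omega>. (Y i \<omega>)\<^sup>2) = v" and "b > 0"
  shows "prob {\<omega> \<in> space M. \<bar>\<Sum>i\<in>I. Y i \<omega>\<bar> > b} \<le> real (card I) * v / b\<^sup>2"
proof -
  have [measurable]: "random_variable borel (Y i)" if "i \<in> I" for i
    using indep that unfolding indep_vars_def2 by simp
  have "prob {\<omega> \<in> space M. \<bar>\<Sum>i\<in>I. Y i \<omega>\<bar> > b} \<le>
      prob {\<omega> \<in> space M. (\<Sum>i\<in>I. Y i \<omega>)\<^sup>2 \<ge> b\<^sup>2}"
  proof (intro finite_measure_mono subsetI)
    fix \<omega> assume "\<omega> \<in> {\<omega> \<in> space M. \<bar>\<Sum>i\<in>I. Y i \<omega>\<bar> > b}"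
    thus "\<omega> \<in> {\<omega> \<in> space M. (\<Sum>i\<in>I. Y i \<omega>)\<^sup>2 \<ge> b\<^sup>2}"
      using \<open>b > 0\<close> by (simp flip: abs_le_square_iff)
  qed measurable
  also have "\<dots> \<le> expectation (\<lambda>\<omega>. (\<Sum>i\<in>I. Y i \<omega>)\<^sup>2) / b\<^sup>2"
    using \<open>b > 0\<close> second_moment_sum_indep(1)[OF assms(1-4)]
    by (intro integral_Markov_inequality_measure[where A = "{}"]) auto
  also have "\<dots> = real (card I) * v / b\<^sup>2"
    by (simp add: second_moment_sum_indep(2)[OF assms(1-4)] mom)
  finally show ?thesis .
qed

section \<open>From additive to relative error\<close>

lemma scaled_derivative_eq:
  assumes "l \<le> n" "n > 0"
  shows "real n powr (real l / 2) * (fact l / fact n) *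
      poly ((pderiv ^^ (n - l)) (root_poly r n)) (x / sqrt (real n)) =
    real n ^ l * fact (n - l) / fact n * esym_scaled (\<lambda>i. x / sqrt (real n) - r i) n l"
proof -
  have "real n powr (real l / 2) = (real n powr (1 / 2)) powr real l"
    by (simp add: powr_powr)
  also have "\<dots> = sqrt (real n) ^ l"
    using assms by (simp add: powr_half_sqrt powr_realpow)
  finally have s: "real n powr (real l / 2) = sqrt (real n) ^ l" .
  have "real n ^ l = sqrt (real n) ^ l * sqrt (real n) ^ l"
    by (simp flip: power_mult_distrib)
  thus ?thesis
    using assms by (simp add: s root_poly_higher_pderiv esym_scaled_def)
qed

text \<open>
  Writing \<open>F - G = c (A - G) + (c - 1) G\<close>, the second summand accounts for at most half of the
  relative error \<open>\<epsilon>\<close>. The rest has to come from \<open>A - G\<close>, which is possible only if \<open>G\<close> is small.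
\<close>

lemma relative_error_imp_small:
  fixes F A G c \<epsilon> \<eta> :: real
  assumes "F = c * A" "\<bar>c - 1\<bar> \<le> 1" "\<bar>c - 1\<bar> \<le> \<epsilon> / 2" "\<bar>A - G\<bar> \<le> \<epsilon> * \<eta> / 4"
    and "\<bar>F - G\<bar> > \<epsilon> * \<bar>G\<bar>" "\<epsilon> > 0"
  shows "\<bar>G\<bar> \<le> \<eta>"
proof -
  have "F - G = c * (A - G) + (c - 1) * G" by (simp add: assms(1) algebra_simps)
  hence "\<bar>F - G\<bar> \<le> \<bar>c\<bar> * \<bar>A - G\<bar> + \<bar>c - 1\<bar> * \<bar>G\<bar>"
    by (metis abs_mult abs_triangle_ineq)
  also have "\<dots> \<le> 2 * (\<epsilon> * \<eta> / 4) + \<epsilon> / 2 * \<bar>G\<bar>"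
    using assms by (intro add_mono mult_mono) auto
  finally have "\<epsilon> * \<bar>G\<bar> < \<epsilon> * \<eta>" using assms(5) by simp
  thus ?thesis using assms(6) by simp
qed

text \<open>
  Only three properties of the roots enter: the normalised sum is tight with an atomless weak limit
  \<open>\<nu>\<close>, the second power sum obeys a law of large numbers, and the higher ones are negligible.
  A sample point with large relative error lies in one of the exceptional events \<open>B1\<close>, \<open>B2\<close>, \<open>B3\<close>
  on which these properties fail, or else \<open>He\<^sub>l\<close> is small there, so that \<open>\<gamma>\<^sub>n\<close> is within \<open>t\<close> of
  \<open>\<rho> - x\<close> for one of finitely many \<open>\<rho>\<close> (the event \<open>S\<close>). The parameters are chosen in the order
  \<open>t\<close>, \<open>\<eta>\<close>, \<open>K\<close>, \<open>\<delta>\<close>.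
\<close>

lemma (in prob_space) scaled_derivative_hermite_in_prob:
  fixes r :: "nat \<Rightarrow> 'a \<Rightarrow> real" and l :: nat and a b :: real
  defines "T n \<omega> \<equiv> power_sum (\<lambda>i. r i \<omega>) n 1 / sqrt (real n)"
  assumes rv: "\<And>i. i \<ge> 1 \<Longrightarrow> random_variable borel (r i)"
    and tight: "\<And>e. e > 0 \<Longrightarrow> \<exists>K. \<forall>\<^sub>F n in sequentially. prob {\<omega> \<in> space M. \<bar>T n \<omega>\<bar> > K} < e"
    and lln: "\<And>\<delta>. \<delta> > 0 \<Longrightarrow>
      (\<lambda>n. prob {\<omega> \<in> space M. \<bar>power_sum (\<lambda>i. r i \<omega>) n 2 / real n - 1\<bar> > \<delta>}) \<longlonglongrightarrow> 0"
    and high: "\<And>\<delta> j. \<delta> > 0 \<Longrightarrow> j \<ge> 3 \<Longrightarrow>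
      (\<lambda>n. prob {\<omega> \<in> space M. power_sum (\<lambda>i. \<bar>r i \<omega>\<bar>) n j / sqrt (real n) ^ j > \<delta>}) \<longlonglongrightarrow> 0"
    and conv: "weak_conv_m (\<lambda>n. distr M borel (\<lambda>\<omega>. - T n \<omega>)) \<nu>" "real_distribution \<nu>"
    and atomless: "\<And>y. measure \<nu> {y} = 0"
  shows "eq_one_plus_o_prob M {a..b}
      (\<lambda>n x \<omega>. real n powr (real l / 2) * (fact l / fact n) *
         poly ((pderiv ^^ (n - l)) (root_poly (\<lambda>i. r i \<omega>) n)) (x / sqrt (real n)))
      (\<lambda>n x \<omega>. hermite_He l (x + - T n \<omega>))"
proof -
  define F where "F n x \<omega> = real n powr (real l / 2) * (fact l / fact n) *
         poly ((pderiv ^^ (n - l)) (root_poly (\<lambda>i. r i \<omega>) n)) (x / sqrt (real n))" for n x \<omega>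
  define G where "G n x \<omega> = hermite_He l (x + - T n \<omega>)" for n x \<omega>
  have ps_rv [measurable]: "random_variable borel (\<lambda>\<omega>. power_sum (\<lambda>i. r i \<omega>) n j)"
      "random_variable borel (\<lambda>\<omega>. power_sum (\<lambda>i. \<bar>r i \<omega>\<bar>) n j)" for n j
    unfolding power_sum_def
    by (intro borel_measurable_sum borel_measurable_power borel_measurable_abs rv; simp)+
  have T_rv [measurable]: "random_variable borel (T n)" for n
    unfolding T_def by measurable
  have "\<forall>\<^sub>F n in sequentially. \<forall>x\<in>{a..b}.
      prob {\<omega> \<in> space M. \<bar>F n x \<omega> - G n x \<omega>\<bar> > \<epsilon> * \<bar>G n x \<omega>\<bar>} < e"
    if \<epsilon>: "\<epsilon> > 0" and e: "e > 0" for \<epsilon> e :: real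
  proof -
    obtain R where R: "finite R" and near: "\<And>t. t > 0 \<Longrightarrow> \<exists>\<eta>>0. \<forall>y. \<bar>poly (hermite_poly l) y\<bar> \<le> \<eta> \<longrightarrow> (\<exists>\<rho>\<in>R. \<bar>y - \<rho>\<bar> < t)"
      using poly_small_near_finite_set[OF hermite_poly_neq_0] by blast
    define C where "C = max \<bar>a\<bar> \<bar>b\<bar>"
    have C: "\<bar>x\<bar> \<le> C" if "x \<in> {a..b}" for x using that by (auto simp: C_def)
    \<comment> \<open>All centres \<open>\<rho> - x\<close> that can occur lie in the compact interval from \<open>-D\<close> to \<open>D\<close>.\<close>
    define D where "D = C + (\<Sum>\<rho>\<in>R. \<bar>\<rho>\<bar>)"
    have D: "\<rho> - x \<in> {-D..D}" if "x \<in> {a..b}" "\<rho> \<in> R" for x \<rho>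
    proof -
      have "\<bar>\<rho>\<bar> \<le> (\<Sum>\<rho>\<in>R. \<bar>\<rho>\<bar>)" using R that by (intro member_le_sum) auto
      thus ?thesis using C[OF that(1)] by (auto simp: D_def)
    qed
    define e' where "e' = e / (2 * (real (card R) + 1))"
    have e': "e' > 0" "real (card R) * e' \<le> e / 2"
      using e by (auto simp: e'_def field_simps)
    obtain t where t: "t > 0" and ball: "\<forall>\<^sub>F n in sequentially. \<forall>y\<in>{-D..D}.
        measure (distr M borel (\<lambda>\<omega>. - T n \<omega>)) {y - t<..<y + t} < e'"
      using weak_conv_small_ball[OF conv(1) _ conv(2) atomless e'(1), of "-D" D] by auto
    obtain \<eta> where \<eta>: "\<eta> > 0"
      "\<And>y. \<bar>poly (hermite_poly l) y\<bar> \<le> \<eta> \<Longrightarrow> \<exists>\<rho>\<in>R. \<bar>y - \<rho>\<bar> < t"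
      using near[OF t] by blast
    obtain K where K: "\<forall>\<^sub>F n in sequentially. prob {\<omega> \<in> space M. \<bar>T n \<omega>\<bar> > K} < e / 8"
      using tight[of "e / 8"] e by auto
    have "\<epsilon> * \<eta> / 4 > 0" using \<epsilon> \<eta>(1) by simp
    then obtain \<delta> where \<delta>: "\<delta> > 0" and approx: "\<And>n x r. 1 \<le> \<delta> * real n \<Longrightarrow> \<bar>x\<bar> \<le> C \<Longrightarrow>
       \<bar>power_sum r n 1 / sqrt (real n)\<bar> \<le> K \<Longrightarrow>
       \<bar>power_sum r n 2 / real n - 1\<bar> \<le> \<delta> \<Longrightarrow>
       (\<And>j. j \<ge> 3 \<Longrightarrow> j \<le> l \<Longrightarrow> power_sum (\<lambda>i. \<bar>r i\<bar>) n j / sqrt (real n) ^ j \<le> \<delta>) \<Longrightarrow>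
       \<bar>esym_scaled (\<lambda>i. x / sqrt (real n) - r i) n l -
          poly (hermite_poly l) (x - power_sum r n 1 / sqrt (real n))\<bar> \<le> \<epsilon> * \<eta> / 4"
      using esym_scaled_near_hermite[of "\<epsilon> * \<eta> / 4" C K l] by blast
    define B1 where "B1 n = {\<omega> \<in> space M. \<bar>T n \<omega>\<bar> > K}" for n
    define B2 where "B2 n = {\<omega> \<in> space M. \<bar>power_sum (\<lambda>i. r i \<omega>) n 2 / real n - 1\<bar> > \<delta>}" for n
    define B3 where "B3 n j = {\<omega> \<in> space M. power_sum (\<lambda>i. \<bar>r i \<omega>\<bar>) n j / sqrt (real n) ^ j > \<delta>}" for n j
    define S where "S n x \<rho> = {\<omega> \<in> space M. - T n \<omega> \<in> {\<rho> - x - t<..<\<rho> - x + t}}" for n x \<rho>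
    have ev: "B1 n \<in> events" "B2 n \<in> events" "B3 n j \<in> events" "S n x \<rho> \<in> events" for n j x \<rho>
      unfolding B1_def B2_def B3_def S_def by measurable
    have ev_Un: "(\<Union>j\<in>{3..l}. B3 n j) \<in> events" "(\<Union>\<rho>\<in>R. S n x \<rho>) \<in> events" for n x
      using R ev by (intro sets.finite_UN; simp)+
    have B2: "\<forall>\<^sub>F n in sequentially. prob (B2 n) < e / 8"
      using order_tendstoD(2)[OF lln[OF \<delta>], of "e / 8"] e unfolding B2_def by simp
    have "(\<lambda>n. \<Sum>j\<in>{3..l}. prob (B3 n j)) \<longlonglongrightarrow> 0"
      unfolding B3_def by (intro tendsto_null_sum high \<delta>) auto
    hence B3: "\<forall>\<^sub>F n in sequentially. (\<Sum>j\<in>{3..l}. prob (B3 n j)) < e / 8"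
      by (rule order_tendstoD(2)) (use e in simp)
    have c: "\<forall>\<^sub>F n in sequentially. \<bar>real n ^ l * fact (n - l) / fact n - 1\<bar> < min 1 (\<epsilon> / 2)"
      using tendstoD[OF falling_factorial_ratio_tendsto, of "min 1 (\<epsilon> / 2)" l] \<epsilon>
      by (simp add: dist_real_def)
    have big: "\<forall>\<^sub>F n in sequentially. 1 \<le> \<delta> * real n"
      using eventually_ge_at_top[of "nat \<lceil>1 / \<delta>\<rceil>"]
    proof eventually_elim
      case (elim n)
      hence "1 / \<delta> \<le> real n" by linarith
      thus ?case using \<delta> by (simp add: field_simps)
    qed
    show ?thesis
      using K[folded B1_def] B2 B3 c big ball eventually_ge_at_top[of l] eventually_gt_at_top[of 0]
    proof eventually_elim
      case (elim n)
      show ?case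
      proof
        fix x assume x: "x \<in> {a..b}"
        have "{\<omega> \<in> space M. \<bar>F n x \<omega> - G n x \<omega>\<bar> > \<epsilon> * \<bar>G n x \<omega>\<bar>} \<subseteq>
            (B1 n \<union> B2 n) \<union> ((\<Union>j\<in>{3..l}. B3 n j) \<union> (\<Union>\<rho>\<in>R. S n x \<rho>))" (is "?E \<subseteq> _")
        proof
          fix \<omega> assume \<omega>: "\<omega> \<in> ?E"
          show "\<omega> \<in> (B1 n \<union> B2 n) \<union> ((\<Union>j\<in>{3..l}. B3 n j) \<union> (\<Union>\<rho>\<in>R. S n x \<rho>))"
          proof (rule ccontr)
            assume not_in: "\<not> ?thesis"
            have A: "\<bar>esym_scaled (\<lambda>i. x / sqrt (real n) - r i \<omega>) n l - G n x \<omega>\<bar> \<le> \<epsilon> * \<eta> / 4"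
              using approx[of n x "\<lambda>i. r i \<omega>", OF elim(5) C[OF x]] not_in \<omega>
              by (fastforce simp: G_def hermite_He_eq_poly T_def B1_def B2_def B3_def not_less)
            have Feq: "F n x \<omega> = real n ^ l * fact (n - l) / fact n *
                esym_scaled (\<lambda>i. x / sqrt (real n) - r i \<omega>) n l"
              unfolding F_def by (rule scaled_derivative_eq[OF elim(7,8)])
            have err: "\<bar>F n x \<omega> - G n x \<omega>\<bar> > \<epsilon> * \<bar>G n x \<omega>\<bar>" using \<omega> by simp
            have "\<bar>G n x \<omega>\<bar> \<le> \<eta>"
              by (rule relative_error_imp_small[OF Feq _ _ A err \<epsilon>]) (use elim(4) in linarith)+
            then obtain \<rho> where "\<rho> \<in> R" "\<bar>x - T n \<omega> - \<rho>\<bar> < t"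
              using \<eta>(2)[of "x - T n \<omega>"] by (auto simp: G_def hermite_He_eq_poly)
            hence "\<omega> \<in> S n x \<rho>" using \<omega> by (auto simp: S_def)
            thus False using not_in \<open>\<rho> \<in> R\<close> by blast
          qed
        qed
        hence "prob ?E \<le> prob ((B1 n \<union> B2 n) \<union> ((\<Union>j\<in>{3..l}. B3 n j) \<union> (\<Union>\<rho>\<in>R. S n x \<rho>)))"
          by (intro finite_measure_mono sets.Un ev ev_Un)
        also have "\<dots> \<le> (prob (B1 n) + prob (B2 n)) + (prob (\<Union>j\<in>{3..l}. B3 n j) + prob (\<Union>\<rho>\<in>R. S n x \<rho>))"
          by (intro order_trans[OF measure_Un_le] add_mono order_refl
              measure_Un_le sets.Un ev ev_Un)
        also have "prob (\<Union>j\<in>{3..l}. B3 n j) \<le> (\<Sum>j\<in>{3..l}. prob (B3 n j))"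
          using ev by (intro measure_subadditive_finite) auto
        also have "prob (\<Union>\<rho>\<in>R. S n x \<rho>) \<le> (\<Sum>\<rho>\<in>R. prob (S n x \<rho>))"
          using R ev by (intro measure_subadditive_finite) auto
        also have "\<dots> \<le> (\<Sum>\<rho>\<in>R. e')"
        proof (rule sum_mono)
          fix \<rho> assume "\<rho> \<in> R"
          have "S n x \<rho> = (\<lambda>\<omega>. - T n \<omega>) -` {\<rho> - x - t<..<\<rho> - x + t} \<inter> space M"
            by (auto simp: S_def)
          hence "prob (S n x \<rho>) = measure (distr M borel (\<lambda>\<omega>. - T n \<omega>)) {\<rho> - x - t<..<\<rho> - x + t}"
            by (simp add: measure_distr)
          thus "prob (S n x \<rho>) \<le> e'" using elim(6) D[OF x \<open>\<rho> \<in> R\<close>] by fastforce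
        qed
        finally show "prob ?E < e" using elim(1-3) e' e by simp
      qed
    qed
  qed
  thus ?thesis
    unfolding eq_one_plus_o_prob_def uniform_limit_iff F_def[symmetric] G_def[symmetric]
    by (simp add: dist_real_def)
qed

section \<open>Independent identically distributed roots\<close>

lemma (in prob_space) indep_vars_reindex_inj:
  assumes indep: "indep_vars M' X (f ` I)" and inj: "inj_on f I"
  shows "indep_vars (\<lambda>i. M' (f i)) (\<lambda>i. X (f i)) I"
proof -
  define \<S> where "\<S> i = {X i -` A \<inter> space M |A. A \<in> sets (M' i)}" for i
  have ind: "indep_sets \<S> (f ` I)" and rv: "\<And>i. i \<in> I \<Longrightarrow> random_variable (M' (f i)) (X (f i))"
    using indep unfolding indep_vars_def2 \<S>_def by auto
  have "indep_sets (\<lambda>i. \<S> (f i)) I"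
  proof (rule indep_setsI)
    fix i assume "i \<in> I"
    thus "\<S> (f i) \<subseteq> events" using ind unfolding indep_sets_def by auto
  next
    fix A J assume J: "J \<noteq> {}" "J \<subseteq> I" "finite J" "\<forall>j\<in>J. A j \<in> \<S> (f j)"
    have inv: "the_inv_into J f (f j) = j" if "j \<in> J" for j
      using that inj_on_subset[OF inj J(2)] by (rule the_inv_into_f_f[rotated])
    have "prob (\<Inter>k\<in>f ` J. A (the_inv_into J f k)) = (\<Prod>k\<in>f ` J. prob (A (the_inv_into J f k)))"
      by (rule indep_setsD[OF ind]) (use J inv in auto)
    thus "prob (\<Inter>j\<in>J. A j) = (\<Prod>j\<in>J. prob (A j))"
      using inv by (simp add: prod.reindex inj_on_subset[OF inj J(2)])
  qed
  thus ?thesis using rv unfolding indep_vars_def2 \<S>_def by auto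
qed

theorem mainTheorem1:
  fixes M :: "'a measure" and N :: "'b measure"
    and r :: "nat \<Rightarrow> 'a \<Rightarrow> real" and X :: "'b \<Rightarrow> real"
    and l :: nat and a b :: real
  assumes "prob_space M" and "prob_space N"
    and "X \<in> borel_measurable N"
    and "prob_space.indep_vars M (\<lambda>_. borel) r {1..}"
    and "\<And>i. i \<ge> 1 \<Longrightarrow> distr M borel (r i) = distr N borel X"
    and "\<And>k::nat. integrable N (\<lambda>\<omega>. \<bar>X \<omega>\<bar> ^ k)"
    and "prob_space.expectation N X = 0"
    and "prob_space.expectation N (\<lambda>\<omega>. (X \<omega>)\<^sup>2) = 1"
    and "a \<le> b"
  shows "\<exists>\<gamma> :: nat \<Rightarrow> 'a \<Rightarrow> real.
    (\<forall>n. \<gamma> n \<in> borel_measurable M) \<and>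
    weak_conv_m (\<lambda>n. distr M borel (\<gamma> n)) std_normal_distribution \<and>
    eq_one_plus_o_prob M {a..b}
      (\<lambda>n x \<omega>. real n powr (real l / 2) * (fact l / fact n) *
         poly ((pderiv ^^ (n - l)) (root_poly (\<lambda>i. r i \<omega>) n)) (x / sqrt (real n)))
      (\<lambda>n x \<omega>. hermite_He l (x + \<gamma> n \<omega>))"
proof -
  interpret prob_space M by fact
  have X_rv [measurable]: "X \<in> borel_measurable N" by fact
  have rv: "random_variable borel (r i)" if "i \<ge> 1" for i
    using assms(4) that unfolding indep_vars_def2 by simp
  have int_eq: "integrable M (\<lambda>\<omega>. f (r i \<omega>)) \<longleftrightarrow> integrable N (\<lambda>\<omega>. f (X \<omega>))"
    and exp_eq: "expectation (\<lambda>\<omega>. f (r i \<omega>)) = (\<integral>\<omega>. f (X \<omega>) \<partial>N)"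
    if "i \<ge> 1" and f: "f \<in> borel_measurable borel" for i and f :: "real \<Rightarrow> real"
    using integrable_distr_eq[OF rv[OF that(1)] f] integral_distr[OF rv[OF that(1)] f]
      integrable_distr_eq[OF X_rv f] integral_distr[OF X_rv f] assms(5)[OF that(1)] by simp_all
  have X_pow: "integrable N (\<lambda>\<omega>. X \<omega> ^ k)" for k
    by (rule Bochner_Integration.integrable_bound[OF assms(6)[of k]]) (auto simp: power_abs)
  have r_pow: "integrable M (\<lambda>\<omega>. r i \<omega> ^ k)" "integrable M (\<lambda>\<omega>. \<bar>r i \<omega>\<bar> ^ k)" if "i \<ge> 1" for i k
    using int_eq[OF that, of "\<lambda>x. x ^ k"] int_eq[OF that, of "\<lambda>x. \<bar>x\<bar> ^ k"] X_pow assms(6) by simp_all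
  have r_mean: "expectation (r i) = 0" if "i \<ge> 1" for i
    using exp_eq[OF that, of "\<lambda>x. x"] assms(7) by simp
  have r_sq: "expectation (\<lambda>\<omega>. (r i \<omega>)\<^sup>2) = 1" if "i \<ge> 1" for i
    using exp_eq[OF that, of "\<lambda>x. x\<^sup>2"] assms(8) by simp
  define T where "T n \<omega> = power_sum (\<lambda>i. r i \<omega>) n 1 / sqrt (real n)" for n \<omega>

  have clt: "weak_conv_m (\<lambda>n. distr M borel (\<lambda>\<omega>. - T n \<omega>)) std_normal_distribution"
  proof -
    \<comment> \<open>The central limit theorem indexes its variables from \<open>0\<close>, the roots are indexed from \<open>1\<close>.\<close>
    define Z where "Z i \<omega> = - r (Suc i) \<omega>" for i \<omega>
    have "indep_vars (\<lambda>_. borel) (\<lambda>i. r (Suc i)) UNIV"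
      by (rule indep_vars_reindex_inj[of "\<lambda>_. borel" r Suc UNIV])
         (auto intro: indep_vars_subset[OF assms(4)])
    hence "indep_vars (\<lambda>_. borel) Z UNIV"
      unfolding Z_def[abs_def] by (rule indep_vars_compose2) simp
    hence "weak_conv_m (\<lambda>n. distr M borel (\<lambda>\<omega>. (\<Sum>i<n. Z i \<omega>) / sqrt (real n * 1\<^sup>2)))
             std_normal_distribution"
    proof (rule central_limit_theorem_zero_mean)
      show mean: "expectation (Z n) = 0" for n
        using r_mean[of "Suc n"] by (simp add: Z_def[abs_def])
      show "integrable M (\<lambda>\<omega>. (Z n \<omega>)\<^sup>2)" for n
        using r_pow(1)[of "Suc n" 2] by (simp add: Z_def)
      show "variance (Z n) = 1\<^sup>2" for n
        unfolding mean using r_sq[of "Suc n"] by (simp add: Z_def)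
      show "distr M borel (Z n) = distr (distr N borel X) borel uminus" for n
        unfolding assms(5)[of "Suc n", symmetric, simplified]
        by (subst distr_distr) (auto simp: Z_def[abs_def] comp_def rv)
    qed simp
    also have "(\<lambda>n \<omega>. (\<Sum>i<n. Z i \<omega>) / sqrt (real n * 1\<^sup>2)) = (\<lambda>n \<omega>. - T n \<omega>)"
    proof (intro ext)
      fix n \<omega>
      have "(\<Sum>i<n. r (Suc i) \<omega>) = (\<Sum>i=1..n. r i \<omega>)"
        by (rule sum.reindex_bij_witness[of _ "\<lambda>i. i - 1" Suc]) auto
      thus "(\<Sum>i<n. Z i \<omega>) / sqrt (real n * 1\<^sup>2) = - T n \<omega>"
        by (simp add: Z_def T_def power_sum_def sum_negf)
    qed
    finally show ?thesis .
  qed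

  have T_rv: "random_variable borel (T n)" for n
    unfolding T_def power_sum_def
    by (intro borel_measurable_divide borel_measurable_sum borel_measurable_power rv) auto
  have "eq_one_plus_o_prob M {a..b}
      (\<lambda>n x \<omega>. real n powr (real l / 2) * (fact l / fact n) *
         poly ((pderiv ^^ (n - l)) (root_poly (\<lambda>i. r i \<omega>) n)) (x / sqrt (real n)))
      (\<lambda>n x \<omega>. hermite_He l (x + - T n \<omega>))"
    unfolding T_def
  proof (rule scaled_derivative_hermite_in_prob[where \<nu> = std_normal_distribution])
    fix e :: real assume e: "e > 0"
    \<comment> \<open>By Chebyshev, the probability that follows is at most \<open>1 / K\<^sup>2 = e / 2\<close>.\<close>
    define K where "K = sqrt (2 / e)"
    have K: "K > 0" "K\<^sup>2 = 2 / e" using e by (simp_all add: K_def)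
    have "\<forall>\<^sub>F n in sequentially. prob {\<omega> \<in> space M. \<bar>T n \<omega>\<bar> > K} < e"
      using eventually_gt_at_top[of 0]
    proof eventually_elim
      case (elim n)
      have "{\<omega> \<in> space M. \<bar>T n \<omega>\<bar> > K} = {\<omega> \<in> space M. \<bar>\<Sum>i=1..n. r i \<omega>\<bar> > K * sqrt (real n)}"
        using elim by (simp add: T_def power_sum_def field_simps)
      also have "prob \<dots> \<le> real (card {1..n}) * 1 / (K * sqrt (real n))\<^sup>2"
        using elim K(1) r_pow(1) r_mean r_sq
        by (intro prob_abs_sum_indep_gt indep_vars_subset[OF assms(4)]) auto
      also have "\<dots> < e" using elim e by (simp add: power_mult_distrib K(2))
      finally show ?case .
    qed
    thus "\<exists>K. \<forall>\<^sub>F n in sequentially.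
        prob {\<omega> \<in> space M. \<bar>power_sum (\<lambda>i. r i \<omega>) n 1 / sqrt (real n)\<bar> > K} < e"
      unfolding T_def by blast
  next
    fix \<delta> :: real assume \<delta>: "\<delta> > 0"
    \<comment> \<open>The fourth moment enters here: Chebyshev is applied to \<open>r\<^sub>i\<^sup>2 - 1\<close>.\<close>
    define v where "v = (\<integral>\<omega>. ((X \<omega>)\<^sup>2 - 1)\<^sup>2 \<partial>N)"
    have le: "\<forall>\<^sub>F n in sequentially.
        norm (prob {\<omega> \<in> space M. \<bar>power_sum (\<lambda>i. r i \<omega>) n 2 / real n - 1\<bar> > \<delta>}) \<le> v / \<delta>\<^sup>2 * (1 / real n)"
      using eventually_gt_at_top[of 0]
    proof eventually_elim
      case (elim n)
      have "power_sum (\<lambda>i. r i \<omega>) n 2 / real n - 1 = (\<Sum>i=1..n. (r i \<omega>)\<^sup>2 - 1) / real n" for \<omega>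
        using elim by (simp add: power_sum_def sum_subtractf field_simps)
      hence "{\<omega> \<in> space M. \<bar>power_sum (\<lambda>i. r i \<omega>) n 2 / real n - 1\<bar> > \<delta>} =
          {\<omega> \<in> space M. \<bar>\<Sum>i=1..n. (r i \<omega>)\<^sup>2 - 1\<bar> > \<delta> * real n}"
        using elim by (simp add: field_simps)
      also have "prob \<dots> \<le> real (card {1..n}) * v / (\<delta> * real n)\<^sup>2"
      proof (intro prob_abs_sum_indep_gt)
        show "indep_vars (\<lambda>_. borel) (\<lambda>i \<omega>. (r i \<omega>)\<^sup>2 - 1) {1..n}"
          by (rule indep_vars_compose2[where Y = "\<lambda>_ x. x\<^sup>2 - 1", OF indep_vars_subset[OF assms(4)]]) auto
        fix i assume "i \<in> {1..n}"
        hence i: "i \<ge> 1" by simp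
        have sq: "((y::real)\<^sup>2 - 1)\<^sup>2 = y ^ 4 - 2 * y ^ 2 + 1" for y
          by (simp add: power2_eq_square algebra_simps power4_eq_xxxx)
        show "integrable M (\<lambda>\<omega>. ((r i \<omega>)\<^sup>2 - 1)\<^sup>2)"
          unfolding sq using r_pow(1)[OF i] by simp
        show "expectation (\<lambda>\<omega>. (r i \<omega>)\<^sup>2 - 1) = 0"
          using r_pow(1)[OF i, of 2] r_sq[OF i] by (simp add: prob_space)
        show "expectation (\<lambda>\<omega>. ((r i \<omega>)\<^sup>2 - 1)\<^sup>2) = v"
          unfolding v_def by (rule exp_eq[OF i]) simp
      qed (use elim \<delta> in auto)
      also have "\<dots> = v / \<delta>\<^sup>2 * (1 / real n)"
        using elim by (simp add: power_mult_distrib power2_eq_square)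
      finally show ?case by simp
    qed
    show "(\<lambda>n. prob {\<omega> \<in> space M. \<bar>power_sum (\<lambda>i. r i \<omega>) n 2 / real n - 1\<bar> > \<delta>}) \<longlonglongrightarrow> 0"
      by (rule Lim_null_comparison[OF le]) real_asymp
  next
    fix \<delta> :: real and j :: nat assume \<delta>: "\<delta> > 0" and j: "j \<ge> 3"
    \<comment> \<open>Markov's inequality gives \<open>m n\<^bsup>1 - j/2\<^esup> / \<delta>\<close>, and \<open>j \<ge> 3\<close> makes the exponent at most \<open>-1/2\<close>.\<close>
    define m where "m = (\<integral>\<omega>. \<bar>X \<omega>\<bar> ^ j \<partial>N)"
    have le: "\<forall>\<^sub>F n in sequentially.
        norm (prob {\<omega> \<in> space M. power_sum (\<lambda>i. \<bar>r i \<omega>\<bar>) n j / sqrt (real n) ^ j > \<delta>})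
          \<le> m / \<delta> * (1 / sqrt (real n))"
      using eventually_gt_at_top[of 0]
    proof eventually_elim
      case (elim n)
      have s: "sqrt (real n) > 0" "sqrt (real n) \<ge> 1" using elim by auto
      have m: "m \<ge> 0" unfolding m_def by simp
      have int: "integrable M (\<lambda>\<omega>. power_sum (\<lambda>i. \<bar>r i \<omega>\<bar>) n j)"
        unfolding power_sum_def by (intro Bochner_Integration.integrable_sum r_pow) auto
      have "prob {\<omega> \<in> space M. power_sum (\<lambda>i. \<bar>r i \<omega>\<bar>) n j / sqrt (real n) ^ j > \<delta>} \<le>
          prob {\<omega> \<in> space M. power_sum (\<lambda>i. \<bar>r i \<omega>\<bar>) n j \<ge> \<delta> * sqrt (real n) ^ j}"
        using s borel_measurable_integrable[OF int]
        by (intro finite_measure_mono) (auto simp: field_simps)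
      also have "\<dots> \<le> expectation (\<lambda>\<omega>. power_sum (\<lambda>i. \<bar>r i \<omega>\<bar>) n j) / (\<delta> * sqrt (real n) ^ j)"
        using \<delta> s int by (intro integral_Markov_inequality_measure[where A = "{}"])
          (auto simp: power_sum_def intro!: sum_nonneg)
      also have "expectation (\<lambda>\<omega>. power_sum (\<lambda>i. \<bar>r i \<omega>\<bar>) n j) = (\<Sum>i=1..n. m)"
      proof -
        have "expectation (\<lambda>\<omega>. \<bar>r i \<omega>\<bar> ^ j) = m" if "i \<ge> 1" for i
          using exp_eq[OF that, of "\<lambda>x. \<bar>x\<bar> ^ j"] by (simp add: m_def)
        moreover have "expectation (\<lambda>\<omega>. power_sum (\<lambda>i. \<bar>r i \<omega>\<bar>) n j) =
            (\<Sum>i=1..n. expectation (\<lambda>\<omega>. \<bar>r i \<omega>\<bar> ^ j))"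
          unfolding power_sum_def by (intro Bochner_Integration.integral_sum r_pow(2)) simp
        ultimately show ?thesis by simp
      qed
      also have "(\<Sum>i=1..n. m) / (\<delta> * sqrt (real n) ^ j) = m / \<delta> * (real n / sqrt (real n) ^ j)"
        by simp
      also have "\<dots> \<le> m / \<delta> * (real n / sqrt (real n) ^ 3)"
        using s m \<delta> j by (intro mult_left_mono divide_left_mono power_increasing) auto
      also have "real n / sqrt (real n) ^ 3 = 1 / sqrt (real n)"
        using s by (simp add: power3_eq_cube field_simps)
      finally show ?case by simp
    qed
    show "(\<lambda>n. prob {\<omega> \<in> space M. power_sum (\<lambda>i. \<bar>r i \<omega>\<bar>) n j / sqrt (real n) ^ j > \<delta>}) \<longlonglongrightarrow> 0"
      by (rule Lim_null_comparison[OF le]) real_asymp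
  next
    show "weak_conv_m (\<lambda>n. distr M borel (\<lambda>\<omega>. - (power_sum (\<lambda>i. r i \<omega>) n 1 / sqrt (real n))))
        std_normal_distribution"
      using clt by (simp only: T_def)
    show "real_distribution std_normal_distribution" by (rule real_dist_normal_dist)
    show "measure std_normal_distribution {y} = 0" for y
      by (simp add: measure_def emeasure_density nn_integral_indicator_singleton)
  qed (rule rv)
  thus ?thesis using clt T_rv
    by (intro exI[of _ "\<lambda>n \<omega>. - T n \<omega>"]) simp
qed

end
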